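(* The elements $c_k=\sum_{j=1}^n\frac{\partial e_k}{\partial\tilde h_j}\,\bar\partial_jx^j-e_k$, $k=1,\dots,n$, belong to the center of the ring $\mathrm{Diff}_{\mathbf h}(n)$, where $e_k=\sum_{i_1<\dots<i_k}\tilde h_{i_1}\cdots\tilde h_{i_k}$ is the $k$-th elementary symmetric function in $\tilde h_1,\dots,\tilde h_n$.
   Context: $n\ge 1$ is an integer; $\mathfrak{k}$ is a commutative ground ring of characteristic zero. $\mathrm{U}(\mathbf h)=\mathfrak{k}[\tilde h_1,\dots,\tilde h_n]$ is the polynomial ring; $\tilde h_{ij}:=\tilde h_i-\tilde h_j$; $\bar{\mathrm U}(\mathbf h)$ is the localization of $\mathrm{U}(\mathbf h)$ at the multiplicative set generated by all $\tilde h_{ij}+k$, $i\ne j$, $k\in\mathbb{Z}$. The ring $\mathrm{Diff}_{\mathbf h}(n)$ of $\mathbf h$-deformed differential operators of type A is the $\mathfrak k$-algebra generated by $\bar{\mathrm U}(\mathbf h)$ and elements $x^j,\bar\partial_j$, $j=1,\dots,n$, with defining relations (for all indices, besides those of $\bar{\mathrm U}(\mathbf h)$; relations for $\tilde h_i$ extend to all of $\bar{\mathrm U}(\mathbf h)$): $$\tilde h_i x^j=x^j(\tilde h_i+\delta_i^j),\qquad \tilde h_i\bar\partial_j=\bar\partial_j(\tilde h_i-\delta_i^j),$$ $$x^ix^j=\frac{\tilde h_{ij}+1}{\tilde h_{ij}}x^jx^i\ (i<j),\qquad \bar\partial_i\bar\partial_j=\frac{\tilde h_{ij}-1}{\tilde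 h_{ij}}\bar\partial_j\bar\partial_i\ (i<j),$$ $$x^i\bar\partial_j=\bar\partial_jx^i\ (i<j),\qquad x^i\bar\partial_j=\frac{\tilde h_{ij}(\tilde h_{ij}-2)}{(\tilde h_{ij}-1)^2}\bar\partial_jx^i\ (i>j),\qquad x^i\bar\partial_i=\sum_{j=1}^n\frac{1}{1-\tilde h_{ij}}\bar\partial_jx^j-1.$$ It is free as a one-sided $\bar{\mathrm U}(\mathbf h)$-module. *)

theory Defs
  imports "HOL-Library.Poly_Mapping" "HOL-Library.Cardinality"
begin

section \<open>The polynomial ring in the variables indexed by \<open>'n\<close>\<close>

text \<open>The index set \<open>{1, \<dots>, n}\<close> is rendered as a finite linearly ordered type \<open>'n\<close>, so that
  \<open>n = CARD('n) \<ge> 1\<close>. Monomials are exponent vectors \<open>'n \<Rightarrow>\<^sub>0 nat\<close>.\<close>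

type_synonym ('k, 'n) hpoly = "('n \<Rightarrow>\<^sub>0 nat) \<Rightarrow>\<^sub>0 'k"

definition hconst :: "'k \<Rightarrow> ('k::comm_ring_1, 'n) hpoly" where
  "hconst c = Poly_Mapping.single 0 c"

definition hvar :: "'n \<Rightarrow> ('k::comm_ring_1, 'n) hpoly" where
  "hvar i = Poly_Mapping.single (Poly_Mapping.single i 1) 1"

definition hdiff :: "'n \<Rightarrow> 'n \<Rightarrow> ('k::comm_ring_1, 'n) hpoly" where
  "hdiff i j = hvar i - hvar j"

definition elem_sym :: "nat \<Rightarrow> ('k::comm_ring_1, 'n::finite) hpoly" where
  "elem_sym k = (\<Sum>I | I \<subseteq> (UNIV :: 'n set) \<and> card I = k. \<Prod>i\<in>I. hvar i)"

definition partial_deriv :: "'n \<Rightarrow> ('k::comm_ring_1, 'n) hpoly \<Rightarrow> ('k, 'n) hpoly" where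
  "partial_deriv j p = (\<Sum>m\<in>Poly_Mapping.keys p.
     Poly_Mapping.single (m - Poly_Mapping.single j 1)
       (of_nat (Poly_Mapping.lookup m j) * Poly_Mapping.lookup p m))"


section \<open>The localization\<close>

inductive_set denoms :: "('k::comm_ring_1, 'n) hpoly set" where
  one: "1 \<in> denoms"
| mult: "i \<noteq> j \<Longrightarrow> s \<in> denoms \<Longrightarrow> (hdiff i j + of_int k) * s \<in> denoms"

lemma denoms_mult: "s \<in> denoms \<Longrightarrow> t \<in> denoms \<Longrightarrow> s * t \<in> denoms"
  by (induction rule: denoms.induct) (auto simp: mult.assoc intro: denoms.mult)

lemma hdiff_add_of_int_in_denoms: "i \<noteq> j \<Longrightarrow> hdiff i j + of_int k \<in> denoms"
  using denoms.mult[OF _ denoms.one] by simp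

lemma hdiff_in_denoms: "i \<noteq> j \<Longrightarrow> hdiff i j \<in> denoms"
  using hdiff_add_of_int_in_denoms[of i j 0] by simp

lemma hdiff_minus_one_in_denoms: "i \<noteq> j \<Longrightarrow> hdiff i j - 1 \<in> denoms"
  using hdiff_add_of_int_in_denoms[of i j "-1"] by simp

lemma hdiff_minus_one_square_in_denoms: "i \<noteq> j \<Longrightarrow> (hdiff i j - 1)\<^sup>2 \<in> denoms"
  by (simp add: power2_eq_square denoms_mult hdiff_minus_one_in_denoms)

lemma one_minus_hdiff_in_denoms: "1 - hdiff i j \<in> denoms"
proof (cases "i = j")
  case True
  then show ?thesis by (simp add: hdiff_def denoms.one)
next
  case False
  have "1 - hdiff i j = hdiff j i + of_int 1" by (simp add: hdiff_def)
  then show ?thesis using False by (metis hdiff_add_of_int_in_denoms)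
qed

lemma lookup_single_mult_add:
  fixes p :: "('k::comm_ring_1, 'n) hpoly"
  shows "Poly_Mapping.lookup (Poly_Mapping.single a r * p) (a + m) = r * Poly_Mapping.lookup p m"
  by (simp add: lookup_mult lookup_single when_mult)

lemma lookup_hvar_mult_eq_0:
  fixes p :: "('k::comm_ring_1, 'n) hpoly"
  assumes "\<And>m'. m = Poly_Mapping.single j 1 + m' \<Longrightarrow> Poly_Mapping.lookup p m' = 0"
  shows "Poly_Mapping.lookup (hvar j * p) m = 0"
proof -
  have "(Poly_Mapping.lookup p q when m = Poly_Mapping.single j 1 + q) = 0" for q
    using assms[of q] by (simp add: when_def)
  then show ?thesis
    by (simp add: hvar_def lookup_mult lookup_single when_mult)
qed

lemma hdiff_add_of_int_regular:
  fixes p :: "('k::comm_ring_1, 'n) hpoly"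
  assumes ij: "i \<noteq> j" and 0: "(hdiff i j + of_int k) * p = 0"
  shows "p = 0"
proof (rule ccontr)
  assume "p \<noteq> 0"
  then have ne: "Poly_Mapping.keys p \<noteq> {}" by simp
  let ?deg = "\<lambda>m. Poly_Mapping.lookup m i"
  let ?M = "Max (?deg ` Poly_Mapping.keys p)"
  have le: "?deg m \<le> ?M" if "m \<in> Poly_Mapping.keys p" for m
    using that by simp
  have "?M \<in> ?deg ` Poly_Mapping.keys p" using ne by (intro Max_in) auto
  then obtain m where m: "m \<in> Poly_Mapping.keys p" "?M = ?deg m" by auto
  have big: "Poly_Mapping.lookup p m' = 0" if "?deg m' = Suc ?M" for m'
    using le[of m'] that by (force simp: in_keys_iff)
  let ?e = "\<lambda>i. Poly_Mapping.single i (1::nat)"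
  have "Poly_Mapping.lookup (hvar j * p) (?e i + m) = 0"
  proof (rule lookup_hvar_mult_eq_0)
    fix m' assume "?e i + m = ?e j + m'"
    then have "Poly_Mapping.lookup (?e i + m) i = Poly_Mapping.lookup (?e j + m') i" by simp
    then show "Poly_Mapping.lookup p m' = 0"
      using ij m(2) by (intro big) (simp add: lookup_add lookup_single)
  qed
  moreover have "Poly_Mapping.lookup (of_int k * p) (?e i + m) = 0"
    using lookup_single_mult_add[of 0 "of_int k" p "?e i + m"] m(2)
    by (simp add: big lookup_add)
  moreover have "Poly_Mapping.lookup (hvar i * p) (?e i + m) = Poly_Mapping.lookup p m"
    using lookup_single_mult_add[of "?e i" 1 p m] by (simp add: hvar_def)
  moreover have "hvar i * p = hvar j * p - of_int k * p"
    using 0 by (simp add: hdiff_def algebra_simps add_eq_0_iff2)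
  ultimately have "Poly_Mapping.lookup p m = 0" by (simp add: lookup_minus)
  then show False using m(1) by (simp add: in_keys_iff)
qed

lemma denoms_regular:
  fixes p :: "('k::comm_ring_1, 'n) hpoly"
  assumes "s \<in> denoms" "s * p = 0"
  shows "p = 0"
  using assms
  by (induction rule: denoms.induct)
     (auto simp: mult.assoc dest: hdiff_add_of_int_regular)

lemma denoms_cancel:
  fixes p :: "('k::comm_ring_1, 'n) hpoly"
  assumes "s \<in> denoms"
  shows "s * p = s * q \<longleftrightarrow> p = q"
  using denoms_regular[OF assms, of "p - q"] by (auto simp: right_diff_distrib)

definition loc_rel :: "('k::comm_ring_1, 'n) hpoly \<times> ('k, 'n) hpoly \<Rightarrow> ('k, 'n) hpoly \<times> ('k, 'n) hpoly \<Rightarrow> bool" where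
  "loc_rel = (\<lambda>(p, s) (q, t). s \<in> denoms \<and> t \<in> denoms \<and> (\<exists>u\<in>denoms. u * (p * t - q * s) = 0))"

lemma loc_rel_iff [simp]:
  "loc_rel (p, s) (q, t) \<longleftrightarrow> s \<in> denoms \<and> t \<in> denoms \<and> p * t = q * s"
  unfolding loc_rel_def using denoms.one by (auto dest: denoms_regular)

lemma part_equivp_loc_rel: "part_equivp loc_rel"
proof (rule part_equivpI)
  show "\<exists>x::('k::comm_ring_1, 'n) hpoly \<times> ('k, 'n) hpoly. loc_rel x x"
    by (rule exI[of _ "(0, 1)"]) (simp add: denoms.one)
  show "symp (loc_rel :: ('k::comm_ring_1, 'n) hpoly \<times> ('k, 'n) hpoly \<Rightarrow> _)"
    by (auto intro!: sympI)
  show "transp (loc_rel :: ('k::comm_ring_1, 'n) hpoly \<times> ('k, 'n) hpoly \<Rightarrow> _)"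
  proof (rule transpI, clarsimp)
    fix p s q t r u :: "('k, 'n) hpoly"
    assume t: "t \<in> denoms" and 1: "p * t = q * s" and 2: "q * u = r * t"
    have "t * (p * u) = (p * t) * u" by (simp add: mult_ac)
    also have "\<dots> = (q * u) * s" unfolding 1 by (simp add: mult_ac)
    also have "\<dots> = t * (r * s)" unfolding 2 by (simp add: mult_ac)
    finally have "t * (p * u) = t * (r * s)" .
    then show "p * u = r * s" using denoms_cancel[OF t] by blast
  qed
qed

quotient_type (overloaded) ('k, 'n) ubar =
  "('k::comm_ring_1, 'n) hpoly \<times> ('k, 'n) hpoly" / partial: loc_rel
  by (rule part_equivp_loc_rel)

lifting_forget poly_mapping.lifting

text \<open>As with division in fields, \<open>loc_frac p s\<close> takes the value \<open>0\<close> outside its domain \<open>s \<in> denoms\<close>.\<close>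

lift_definition loc_frac :: "('k::comm_ring_1, 'n) hpoly \<Rightarrow> ('k, 'n) hpoly \<Rightarrow> ('k, 'n) ubar"
  is "\<lambda>p s. if s \<in> denoms then (p, s) else (0, 1)"
  by (auto simp: denoms.one)

definition of_hpoly :: "('k::comm_ring_1, 'n) hpoly \<Rightarrow> ('k, 'n) ubar" where
  "of_hpoly p = loc_frac p 1"

instantiation ubar :: (comm_ring_1, type) comm_ring_1
begin

lift_definition zero_ubar :: "('a, 'b) ubar" is "(0, 1)"
  by (simp add: denoms.one)

lift_definition one_ubar :: "('a, 'b) ubar" is "(1, 1)"
  by (simp add: denoms.one)

lift_definition plus_ubar :: "('a, 'b) ubar \<Rightarrow> ('a, 'b) ubar \<Rightarrow> ('a, 'b) ubar"
  is "\<lambda>(p, s) (q, t). (p * t + q * s, s * t)"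
  apply (clarsimp simp: denoms_mult)
  subgoal premises prems for p s p' s' q t q' t'
  proof -
    have "p * t * (s' * t') + q * s * (s' * t') = (p * s') * (t * t') + (q * t') * (s * s')"
      by (simp add: mult_ac)
    also have "\<dots> = (p' * s) * (t * t') + (q' * t) * (s * s')" using prems by simp
    finally show ?thesis by (simp add: algebra_simps)
  qed
  done

lift_definition uminus_ubar :: "('a, 'b) ubar \<Rightarrow> ('a, 'b) ubar" is "\<lambda>(p, s). (- p, s)"
  by clarsimp

definition minus_ubar :: "('a, 'b) ubar \<Rightarrow> ('a, 'b) ubar \<Rightarrow> ('a, 'b) ubar" where
  "minus_ubar a b = a + - b"

lift_definition times_ubar :: "('a, 'b) ubar \<Rightarrow> ('a, 'b) ubar \<Rightarrow> ('a, 'b) ubar"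
  is "\<lambda>(p, s) (q, t). (p * q, s * t)"
  apply (clarsimp simp: denoms_mult)
  subgoal premises prems for p s p' s' q t q' t'
  proof -
    have "p * q * (s' * t') = (p * s') * (q * t')" by (simp add: mult_ac)
    also have "\<dots> = (p' * s) * (q' * t)" using prems by simp
    finally show ?thesis by (simp add: mult_ac)
  qed
  done

instance
proof
  fix a b d :: "('a, 'b) ubar"
  show "a * b * d = a * (b * d)"
    by transfer (clarsimp simp: denoms_mult mult.assoc)
  show "a * b = b * a"
    by transfer (clarsimp simp: denoms_mult mult.commute)
  show "1 * a = a"
    by transfer (clarsimp simp: denoms.one)
  show "a + b + d = a + (b + d)"
    by transfer (clarsimp simp: denoms_mult, simp add: algebra_simps)
  show "a + b = b + a"
    by transfer (clarsimp simp: denoms_mult, simp add: algebra_simps)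
  show "0 + a = a"
    by transfer (clarsimp simp: denoms.one)
  show "- a + a = 0"
    by transfer (clarsimp simp: denoms.one denoms_mult)
  show "a - b = a + - b"
    by (simp add: minus_ubar_def)
  show "(a + b) * d = a * d + b * d"
    by transfer (clarsimp simp: denoms_mult, simp add: algebra_simps)
  show "(0 :: ('a, 'b) ubar) \<noteq> 1"
    by transfer (simp add: denoms.one)
qed

end

lemma loc_frac_eq_iff:
  "s \<in> denoms \<Longrightarrow> t \<in> denoms \<Longrightarrow> loc_frac p s = loc_frac q t \<longleftrightarrow> p * t = q * s"
  by transfer simp

lemma loc_frac_add:
  "s \<in> denoms \<Longrightarrow> t \<in> denoms \<Longrightarrow> loc_frac p s + loc_frac q t = loc_frac (p * t + q * s) (s * t)"
  by transfer (simp add: denoms_mult)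

lemma loc_frac_mult:
  "s \<in> denoms \<Longrightarrow> t \<in> denoms \<Longrightarrow> loc_frac p s * loc_frac q t = loc_frac (p * q) (s * t)"
  by transfer (simp add: denoms_mult)


section \<open>The free algebra\<close>

datatype 'g free_monoid = Word (letters: "'g list")

instantiation free_monoid :: (type) monoid_add
begin

definition zero_free_monoid :: "'a free_monoid" where
  "zero_free_monoid = Word []"

definition plus_free_monoid :: "'a free_monoid \<Rightarrow> 'a free_monoid \<Rightarrow> 'a free_monoid" where
  "plus_free_monoid v w = Word (letters v @ letters w)"

instance
  by standard (simp_all add: zero_free_monoid_def plus_free_monoid_def)

end

datatype ('r, 'n) generator = Coef 'r | X 'n | Dbar 'n

text \<open>The monoid algebra of the free monoid on the generators, with coefficients in the
  ground ring. The word monoid is written additively, because \<^type>\<open>poly_mapping\<close> convolves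
  along addition.\<close>

type_synonym ('k, 'n) free_alg = "(('k, 'n) ubar, 'n) generator free_monoid \<Rightarrow>\<^sub>0 'k"

definition gen :: "(('k::comm_ring_1, 'n) ubar, 'n) generator \<Rightarrow> ('k, 'n) free_alg" where
  "gen g = Poly_Mapping.single (Word [g]) 1"

definition scalar :: "'k \<Rightarrow> ('k::comm_ring_1, 'n) free_alg" where
  "scalar c = Poly_Mapping.single 0 c"


section \<open>The ring of \<open>h\<close>-deformed differential operators\<close>

text \<open>The pairs of sides of the defining relations. Since \<^const>\<open>scalar\<close> values are
  central in the free algebra, the first three clauses make \<^const>\<open>Coef\<close> a
  homomorphism of unital algebras over the ground ring. In the last clause the summand \<open>j = i\<close>
  has denominator \<open>1\<close>.\<close>

inductive defrel :: "('k::comm_ring_1, 'n::{finite, linorder}) free_alg \<Rightarrow> ('k, 'n) free_alg \<Rightarrow> bool" where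
  coef_add: "defrel (gen (Coef (a + b))) (gen (Coef a) + gen (Coef b))"
| coef_mult: "defrel (gen (Coef (a * b))) (gen (Coef a) * gen (Coef b))"
| coef_scalar: "defrel (gen (Coef (of_hpoly (hconst c)))) (scalar c)"
| h_x: "defrel (gen (Coef (of_hpoly (hvar i))) * gen (X j))
          (gen (X j) * gen (Coef (of_hpoly (hvar i + (if i = j then 1 else 0)))))"
| h_d: "defrel (gen (Coef (of_hpoly (hvar i))) * gen (Dbar j))
          (gen (Dbar j) * gen (Coef (of_hpoly (hvar i - (if i = j then 1 else 0)))))"
| x_x: "i < j \<Longrightarrow> defrel (gen (X i) * gen (X j))
          (gen (Coef (loc_frac (hdiff i j + 1) (hdiff i j))) * gen (X j) * gen (X i))"
| d_d: "i < j \<Longrightarrow> defrel (gen (Dbar i) * gen (Dbar j))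
          (gen (Coef (loc_frac (hdiff i j - 1) (hdiff i j))) * gen (Dbar j) * gen (Dbar i))"
| x_d_less: "i < j \<Longrightarrow> defrel (gen (X i) * gen (Dbar j)) (gen (Dbar j) * gen (X i))"
| x_d_greater: "i > j \<Longrightarrow> defrel (gen (X i) * gen (Dbar j))
          (gen (Coef (loc_frac (hdiff i j * (hdiff i j - 2)) ((hdiff i j - 1)\<^sup>2)))
            * gen (Dbar j) * gen (X i))"
| x_d_same: "defrel (gen (X i) * gen (Dbar i))
          ((\<Sum>j\<in>UNIV. gen (Coef (loc_frac 1 (1 - hdiff i j))) * gen (Dbar j) * gen (X j)) - 1)"

inductive_set defideal :: "('k::comm_ring_1, 'n::{finite, linorder}) free_alg set" where
  zero: "0 \<in> defideal"
| rel: "defrel a b \<Longrightarrow> a - b \<in> defideal"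
| add: "a \<in> defideal \<Longrightarrow> b \<in> defideal \<Longrightarrow> a + b \<in> defideal"
| lmult: "a \<in> defideal \<Longrightarrow> r * a \<in> defideal"
| rmult: "a \<in> defideal \<Longrightarrow> a * r \<in> defideal"

lemma defideal_uminus: "a \<in> defideal \<Longrightarrow> - a \<in> defideal"
  using defideal.lmult[of a "- 1"] by simp

definition diff_rel :: "('k::comm_ring_1, 'n::{finite, linorder}) free_alg \<Rightarrow> ('k, 'n) free_alg \<Rightarrow> bool" where
  "diff_rel a b \<longleftrightarrow> a - b \<in> defideal"

lemma equivp_diff_rel: "equivp diff_rel"
proof (rule equivpI)
  show "reflp diff_rel" by (simp add: reflp_def diff_rel_def defideal.zero)
  show "symp diff_rel" unfolding symp_def diff_rel_def using defideal_uminus by fastforce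
  show "transp diff_rel" unfolding transp_def diff_rel_def using defideal.add by fastforce
qed

quotient_type (overloaded) ('k, 'n) Diff =
  "('k::comm_ring_1, 'n::{finite, linorder}) free_alg" / diff_rel
  by (rule equivp_diff_rel)

text \<open>The class \<^class>\<open>ring_1\<close> would in addition require \<open>0 \<noteq> 1\<close>; unital rings in the
  sense used here are \<^class>\<open>ring\<close> together with \<^class>\<open>monoid_mult\<close>.\<close>

instantiation Diff :: (comm_ring_1, "{finite, linorder}") "{ring, monoid_mult}"
begin

lift_definition zero_Diff :: "('a, 'b) Diff" is 0 .

lift_definition one_Diff :: "('a, 'b) Diff" is 1 .

lift_definition plus_Diff :: "('a, 'b) Diff \<Rightarrow> ('a, 'b) Diff \<Rightarrow> ('a, 'b) Diff" is "(+)"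
  subgoal for a a' b b'
    using defideal.add[of "a - a'" "b - b'"] by (simp add: diff_rel_def algebra_simps)
  done

lift_definition uminus_Diff :: "('a, 'b) Diff \<Rightarrow> ('a, 'b) Diff" is uminus
  subgoal for a a'
    using defideal_uminus[of "a - a'"] by (simp add: diff_rel_def)
  done

definition minus_Diff :: "('a, 'b) Diff \<Rightarrow> ('a, 'b) Diff \<Rightarrow> ('a, 'b) Diff" where
  "minus_Diff a b = a + - b"

lift_definition times_Diff :: "('a, 'b) Diff \<Rightarrow> ('a, 'b) Diff \<Rightarrow> ('a, 'b) Diff" is "(*)"
  subgoal for a a' b b'
    using defideal.add[OF defideal.rmult[of "a - a'" b] defideal.lmult[of "b - b'" a']]
    by (simp add: diff_rel_def algebra_simps)
  done

instance
proof
  fix a b d :: "('a, 'b) Diff"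
  have eqI: "diff_rel u v" if "u = v" for u v :: "('a, 'b) free_alg"
    using that by (simp add: diff_rel_def defideal.zero)
  show "a + b + d = a + (b + d)" by transfer (rule eqI, simp add: add.assoc)
  show "a + b = b + a" by transfer (rule eqI, simp add: add.commute)
  show "0 + a = a" by transfer (rule eqI, simp)
  show "- a + a = 0" by transfer (rule eqI, simp)
  show "a - b = a + - b" by (simp add: minus_Diff_def)
  show "a * b * d = a * (b * d)" by transfer (rule eqI, simp add: mult.assoc)
  show "(a + b) * d = a * d + b * d" by transfer (rule eqI, simp add: distrib_right)
  show "a * (b + d) = a * b + a * d" by transfer (rule eqI, simp add: distrib_left)
  show "1 * a = a" by transfer (rule eqI, simp)
  show "a * 1 = a" by transfer (rule eqI, simp)
qed

end

lift_definition coef :: "('k::comm_ring_1, 'n::{finite, linorder}) ubar \<Rightarrow> ('k, 'n) Diff"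
  is "\<lambda>a. gen (Coef a)" .

lift_definition xgen :: "'n::{finite, linorder} \<Rightarrow> ('k::comm_ring_1, 'n) Diff"
  is "\<lambda>i. gen (X i)" .

lift_definition dgen :: "'n::{finite, linorder} \<Rightarrow> ('k::comm_ring_1, 'n) Diff"
  is "\<lambda>i. gen (Dbar i)" .

lemma Diff_eq_of_defrel: "defrel a b \<Longrightarrow> abs_Diff a = abs_Diff b"
  by (simp add: Diff.abs_eq_iff diff_rel_def defideal.rel)

lemma abs_Diff_sum: "finite A \<Longrightarrow> abs_Diff (\<Sum>i\<in>A. f i) = (\<Sum>i\<in>A. abs_Diff (f i))"
  by (induction rule: finite_induct)
     (simp_all add: zero_Diff.abs_eq flip: plus_Diff.abs_eq)

lemma abs_Diff_diff: "abs_Diff (a - b) = abs_Diff a - abs_Diff b"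
  by (simp add: minus_Diff_def plus_Diff.abs_eq uminus_Diff.abs_eq)

lemmas Diff_abs_eqs = coef.abs_eq xgen.abs_eq dgen.abs_eq one_Diff.abs_eq
  plus_Diff.abs_eq times_Diff.abs_eq abs_Diff_sum abs_Diff_diff

lemma coef_hom:
  fixes a b :: "('k::comm_ring_1, 'n::{finite, linorder}) ubar"
  shows "coef (a + b) = coef a + coef b" "coef (a * b) = coef a * coef b"
    "coef 1 = (1 :: ('k, 'n) Diff)"
proof -
  show "coef (a + b) = coef a + coef b" "coef (a * b) = coef a * coef b"
    using defrel.coef_add[THEN Diff_eq_of_defrel, of a b]
      defrel.coef_mult[THEN Diff_eq_of_defrel, of a b]
    by (simp_all add: Diff_abs_eqs)
  have "of_hpoly (hconst 1) = (1 :: ('k, 'n) ubar)"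
    unfolding of_hpoly_def hconst_def by transfer (simp add: denoms.one)
  moreover have "coef (of_hpoly (hconst 1)) = (1 :: ('k, 'n) Diff)"
    using defrel.coef_scalar[THEN Diff_eq_of_defrel, of "1 :: 'k"]
    by (simp add: Diff_abs_eqs scalar_def)
  ultimately show "coef 1 = (1 :: ('k, 'n) Diff)" by simp
qed

lemma Diff_relations:
  "coef (of_hpoly (hvar i)) * xgen j
     = xgen j * coef (of_hpoly (hvar i + (if i = j then 1 else 0)))"
  "coef (of_hpoly (hvar i)) * dgen j
     = dgen j * coef (of_hpoly (hvar i - (if i = j then 1 else 0)))"
  "i < j \<Longrightarrow> xgen i * xgen j = coef (loc_frac (hdiff i j + 1) (hdiff i j)) * xgen j * xgen i"
  "i < j \<Longrightarrow> dgen i * dgen j = coef (loc_frac (hdiff i j - 1) (hdiff i j)) * dgen j * dgen i"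
  "i < j \<Longrightarrow> xgen i * dgen j = dgen j * xgen i"
  "i > j \<Longrightarrow> xgen i * dgen j
     = coef (loc_frac (hdiff i j * (hdiff i j - 2)) ((hdiff i j - 1)\<^sup>2)) * dgen j * xgen i"
  "xgen i * dgen i = (\<Sum>j\<in>UNIV. coef (loc_frac 1 (1 - hdiff i j)) * dgen j * xgen j) - 1"
  using defrel.intros(4-9)[THEN Diff_eq_of_defrel, of i j]
    defrel.x_d_greater[THEN Diff_eq_of_defrel, of j i] defrel.x_d_same[THEN Diff_eq_of_defrel, of i]
  by (simp_all only: Diff_abs_eqs finite True_implies_equals)

definition ring_center :: "'a::semigroup_mult set" where
  "ring_center = {z. \<forall>a. z * a = a * z}"

definition c_elem :: "nat \<Rightarrow> ('k::comm_ring_1, 'n::{finite, linorder}) Diff" where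
  "c_elem k = (\<Sum>j\<in>UNIV. coef (of_hpoly (partial_deriv j (elem_sym k))) * dgen j * xgen j)
           - coef (of_hpoly (elem_sym k))"

end

theory Submission
  imports Defs
begin

text \<open>
  Write \<open>x_i\<close>, \<open>D_i\<close>, \<open>h_i\<close> for the generators, \<open>h_ij = h_i - h_j\<close> and \<open>N_j = D_j x_j\<close>. Each \<open>N_j\<close>
  has weight zero, so it commutes with all coefficients, and hence so does
  \<open>c_k = \<Sum>_j e_{k-1}(h without h_j) N_j - e_k(h)\<close>. It remains to compare \<open>c_k\<close> with \<open>x_i\<close> and \<open>D_i\<close>.

  Carrying \<open>x_i\<close> through \<open>N_j\<close>, one exchange with \<open>D_j\<close> and one with \<open>x_j\<close>, gives for \<open>j \<noteq> i\<close>
  the factor \<open>h_ij / (h_ij - 1)\<close>, for \<open>i < j\<close> as for \<open>i > j\<close>: the asymmetry of the two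
  kinds of relations cancels. For \<open>j = i\<close> the inhomogeneous relation gives
  \<open>x_i N_i = (\<Sum>_j 1/(1 - h_ij) N_j - 1) x_i\<close>. With \<open>g = h_i - 1\<close> and \<open>w_j = 1/(g - h_j)\<close> this reads
  \<open>x_i N_j = (g - h_j + 1) w_j N_j x_i\<close> and
  \<open>x_i N_i = N_i x_i - \<Sum>_{j\<noteq>i} w_j N_j x_i - x_i\<close> (\<open>xgen_dx\<close>, \<open>xgen_dx_same\<close>).
  The same formulas, now with \<open>g = h_i\<close>, express \<open>N_j D_i\<close> through the products \<open>D_i N_j\<close>
  (\<open>dx_dgen\<close>, \<open>dx_dgen_same\<close>).

  On the coefficients, passing \<open>x_i\<close> from left to right replaces \<open>h_i\<close> by \<open>h_i - 1\<close>, and passing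
  \<open>D_i\<close> replaces \<open>h_i\<close> by \<open>h_i + 1\<close>. So both commutation relations say that a combination
  of the products of one order, with coefficients evaluated at \<open>h_i = g\<close>, equals the same
  combination of those of the other order, with coefficients evaluated at \<open>h_i = g + 1\<close> (\<open>esym_combination_exchange\<close>).
  Comparing the coefficients of \<open>N_j\<close> leaves an identity of rational functions: with \<open>P\<close> and \<open>Q\<close>
  the symmetric functions \<open>e_{k-1}\<close> and \<open>e_{k-2}\<close> of the variables other than \<open>h_i, h_j\<close>,
  \<open>(P + g Q) (g - h_j + 1) w_j - (P + h_j Q) w_j = P + (g + 1) Q\<close> (\<open>esym_exchange\<close>).
  The remaining terms match because \<open>e_k\<close> is affine in \<open>h_i\<close> (\<open>esym_shift\<close>).
\<close>

section \<open>Elementary symmetric functions\<close>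

text \<open>The family and the index set are arguments, so that a substitution \<open>h_i \<mapsto> g\<close> is a change of
  the family and the derivative by \<open>h_j\<close> omits \<open>j\<close> from the index set and lowers the degree.\<close>

definition esym :: "('i \<Rightarrow> 'a::comm_semiring_1) \<Rightarrow> 'i set \<Rightarrow> nat \<Rightarrow> 'a" where
  "esym f S k = (\<Sum>I | I \<subseteq> S \<and> card I = k. \<Prod>i\<in>I. f i)"

lemma esym_cong: "(\<And>i. i \<in> S \<Longrightarrow> f i = g i) \<Longrightarrow> esym f S k = esym g S k"
  unfolding esym_def by (intro sum.cong prod.cong) auto

lemma esym_0: "finite S \<Longrightarrow> esym f S 0 = 1"
proof -
  assume "finite S"
  then have "{I. I \<subseteq> S \<and> card I = 0} = {{}}"
    by (auto dest: finite_subset)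
  then show ?thesis by (simp add: esym_def)
qed

lemma esym_insert:
  assumes "finite S" "i \<notin> S"
  shows "esym f (insert i S) (Suc k) = esym f S (Suc k) + f i * esym f S k"
proof -
  let ?P = "\<lambda>k. {I. I \<subseteq> S \<and> card I = k}"
  have fin: "finite (?P k)" for k
    using assms(1) by simp
  have split: "{I. I \<subseteq> insert i S \<and> card I = Suc k} = ?P (Suc k) \<union> insert i ` ?P k"
  proof (intro set_eqI iffI)
    fix I assume I: "I \<in> {I. I \<subseteq> insert i S \<and> card I = Suc k}"
    show "I \<in> ?P (Suc k) \<union> insert i ` ?P k"
    proof (cases "i \<in> I")
      case True
      then have "I = insert i (I - {i})" "I - {i} \<in> ?P k" using I by auto
      then show ?thesis by blast
    qed (use I in auto)
  next
    fix I assume "I \<in> ?P (Suc k) \<union> insert i ` ?P k"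
    then show "I \<in> {I. I \<subseteq> insert i S \<and> card I = Suc k}"
      using assms finite_subset[OF _ assms(1)] by (auto simp: card_insert_if)
  qed
  have inj: "inj_on (insert i) (?P k)"
    by (rule inj_on_inverseI[where g = "\<lambda>I. I - {i}"]) (use assms(2) in auto)
  have "esym f (insert i S) (Suc k) = esym f S (Suc k) + (\<Sum>I\<in>insert i ` ?P k. prod f I)"
    unfolding esym_def split using assms fin by (intro sum.union_disjoint) auto
  also have "(\<Sum>I\<in>insert i ` ?P k. prod f I) = (\<Sum>I\<in>?P k. f i * prod f I)"
    unfolding sum.reindex[OF inj] o_def
    using assms finite_subset[OF _ assms(1)] by (intro sum.cong prod.insert) auto
  finally show ?thesis by (simp add: esym_def sum_distrib_left)
qed

lemma esym_remove:
  assumes "finite S" "i \<in> S"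
  shows "esym f S (Suc k) = esym f (S - {i}) (Suc k) + f i * esym f (S - {i}) k"
  using esym_insert[of "S - {i}" i f k] assms by (simp add: insert_absorb)

lemma esym_update_other: "i \<notin> S \<Longrightarrow> esym (f(i := c)) S k = esym f S k"
  by (rule esym_cong) auto

text \<open>Affineness in the \<open>i\<close>-th variable: raising it by one adds the derivative.\<close>

lemma esym_shift:
  fixes f :: "'n::finite \<Rightarrow> 'a::comm_ring_1"
  shows "esym (f(i := g + 1)) UNIV (Suc m)
    = esym (f(i := g)) UNIV (Suc m) + esym (f(i := g)) (UNIV - {i}) m"
  by (simp add: esym_remove[where S = UNIV and i = i] esym_update_other algebra_simps)

text \<open>The identity behind the centrality of \<open>c_k\<close>. Both symmetric functions on the left are
  affine with the same two coefficients \<open>P\<close> and \<open>Q\<close>, one in \<open>g\<close> and the other in \<open>f j\<close>, so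
  that the left-hand side becomes \<open>w * (g - f j)\<close> times the right-hand side.\<close>

lemma esym_exchange:
  fixes f :: "'n::finite \<Rightarrow> 'a::comm_ring_1"
  assumes ij: "i \<noteq> j" and w: "w * (g - f j) = 1"
  shows "esym (f(i := g)) (UNIV - {j}) m * ((g - f j + 1) * w) - esym (f(i := g)) (UNIV - {i}) m * w
    = esym (f(i := g + 1)) (UNIV - {j}) m"
proof -
  obtain P Q where PQ: "\<And>c. esym (f(i := c)) (UNIV - {j}) m = P + c * Q"
    "\<And>c. esym (f(i := c)) (UNIV - {i}) m = P + f j * Q"
  proof (cases m)
    case 0
    \<comment> \<open>Here \<open>Q\<close> would be the symmetric function of degree \<open>-1\<close>.\<close>
    then show ?thesis using that[of 1 0] by (simp add: esym_0)
  next
    case (Suc m')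
    let ?S = "UNIV - {i} - {j}"
    have "UNIV - {j} - {i} = ?S" by auto
    then have "esym (f(i := c)) (UNIV - {j}) m = esym f ?S m + c * esym f ?S m'" for c
      using ij Suc esym_remove[of "UNIV - {j}" i "f(i := c)" m'] by (simp add: esym_update_other)
    moreover have "esym (f(i := c)) (UNIV - {i}) m = esym f ?S m + f j * esym f ?S m'" for c
      using ij Suc esym_remove[of "UNIV - {i}" j "f(i := c)" m'] by (simp add: esym_update_other)
    ultimately show ?thesis by (rule that)
  qed
  have "(P + g * Q) * ((g - f j + 1) * w) - (P + f j * Q) * w = w * (g - f j) * (P + (g + 1) * Q)"
    by (simp add: algebra_simps)
  then show ?thesis unfolding PQ w by simp
qed

section \<open>Polynomials and their derivatives\<close>

text \<open>Used for polynomials, for their exponent vectors, and for elements of the free algebra.\<close>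

lemma poly_mapping_single_induct [case_names zero single add]:
  fixes p :: "'a \<Rightarrow>\<^sub>0 'b::comm_monoid_add"
  assumes zero: "P 0" and single: "\<And>m c. P (Poly_Mapping.single m c)"
    and add: "\<And>p q. P p \<Longrightarrow> P q \<Longrightarrow> P (p + q)"
  shows "P p"
proof (induction p rule: update_induct)
  case const
  then show ?case by (rule zero)
next
  case (update p m c)
  have "Poly_Mapping.lookup p m = 0"
    using update by (simp add: in_keys_iff)
  then have "Poly_Mapping.update m c p = p + Poly_Mapping.single m c"
    by (intro poly_mapping_eqI) (auto simp: lookup_update lookup_add lookup_single when_def)
  then show ?case using add[OF update(3) single] by simp
qed

lemma hpoly_induct [case_names const var add mult]:
  fixes p :: "('k::comm_ring_1, 'n) hpoly"
  assumes const: "\<And>c. P (hconst c)" and var: "\<And>i. P (hvar i)"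
    and add: "\<And>p q. P p \<Longrightarrow> P q \<Longrightarrow> P (p + q)" and mult: "\<And>p q. P p \<Longrightarrow> P q \<Longrightarrow> P (p * q)"
  shows "P p"
proof -
  have power: "P (Poly_Mapping.single (Poly_Mapping.single i n) 1)" for i n
  proof (induction n)
    case 0
    then show ?case using const[of 1] by (simp add: hconst_def)
  next
    case (Suc n)
    have "Poly_Mapping.single (Poly_Mapping.single i (Suc n)) 1
        = (hvar i :: ('k, 'n) hpoly) * Poly_Mapping.single (Poly_Mapping.single i n) 1"
      by (simp add: hvar_def mult_single flip: single_add)
    then show ?case using mult[OF var Suc] by simp
  qed
  have monomial: "P (Poly_Mapping.single m 1)" for m :: "'n \<Rightarrow>\<^sub>0 nat"
  proof (induction m rule: poly_mapping_single_induct)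
    case zero
    then show ?case using const[of 1] by (simp add: hconst_def)
  next
    case (single i n)
    then show ?case by (rule power)
  next
    case (add m m')
    then show ?case using mult[of "Poly_Mapping.single m 1" "Poly_Mapping.single m' 1"]
      by (simp add: mult_single)
  qed
  show ?thesis
  proof (induction p rule: poly_mapping_single_induct)
    case zero
    then show ?case using const[of 0] by (simp add: hconst_def)
  next
    case (single m c)
    then show ?case using mult[OF const[of c] monomial[of m]] by (simp add: hconst_def mult_single)
  qed (rule add)
qed

text \<open>The sum over the support in the definition is not additive as it stands; over a common finite
  superset it is.\<close>

lemma partial_deriv_superset:
  assumes "finite A" "Poly_Mapping.keys p \<subseteq> A"
  shows "partial_deriv j p = (\<Sum>m\<in>A. Poly_Mapping.single (m - Poly_Mapping.single j 1)
       (of_nat (Poly_Mapping.lookup m j) * Poly_Mapping.lookup p m))"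
  unfolding partial_deriv_def using assms by (intro sum.mono_neutral_left) (auto simp: in_keys_iff)

lemma partial_deriv_add: "partial_deriv j (p + q) = partial_deriv j p + partial_deriv j q"
proof -
  let ?A = "Poly_Mapping.keys p \<union> Poly_Mapping.keys q"
  have "Poly_Mapping.keys (p + q) \<subseteq> ?A" by (rule Poly_Mapping.keys_add)
  then show ?thesis
    by (simp add: partial_deriv_superset[of ?A] lookup_add single_add distrib_left sum.distrib)
qed

lemma partial_deriv_sum: "partial_deriv j (\<Sum>i\<in>A. p i) = (\<Sum>i\<in>A. partial_deriv j (p i))"
proof (induction A rule: infinite_finite_induct)
qed (simp_all add: partial_deriv_add, simp_all add: partial_deriv_def)

lemma prod_hvar:
  "finite I \<Longrightarrow> (\<Prod>i\<in>I. hvar i :: ('k::comm_ring_1, 'n) hpoly)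
    = Poly_Mapping.single (\<Sum>i\<in>I. Poly_Mapping.single i 1) 1"
  by (induction rule: finite_induct) (simp_all add: hvar_def mult_single)

lemma partial_deriv_prod_hvar:
  assumes "finite I"
  shows "partial_deriv j (\<Prod>i\<in>I. hvar i :: ('k::comm_ring_1, 'n) hpoly)
    = (if j \<in> I then \<Prod>i\<in>I - {j}. hvar i else 0)"
proof -
  let ?m = "\<lambda>I. \<Sum>i\<in>I. Poly_Mapping.single i (1::nat)"
  have "Poly_Mapping.lookup (?m I) j = of_bool (j \<in> I)"
    using assms by (simp add: lookup_sum lookup_single when_def)
  moreover have "?m I - Poly_Mapping.single j 1 = ?m (I - {j})" if "j \<in> I"
    using assms that by (simp add: sum.remove[of I j])
  ultimately show ?thesis
    using assms by (auto simp: prod_hvar partial_deriv_def)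
qed

lemma elem_sym_eq_esym: "elem_sym k = esym hvar UNIV k"
  by (simp add: elem_sym_def esym_def)

text \<open>A square-free monomial survives differentiation only if it contains the variable, and the
  sets of \<open>m + 1\<close> variables that contain \<open>j\<close> correspond to sets of \<open>m\<close> others.\<close>

lemma partial_deriv_elem_sym:
  "partial_deriv j (elem_sym (Suc m) :: ('k::comm_ring_1, 'n::finite) hpoly) = esym hvar (UNIV - {j}) m"
proof -
  let ?A = "{I :: 'n set. I \<subseteq> UNIV - {j} \<and> card I = m}"
  have eq: "{I. card I = Suc m \<and> j \<in> I} = insert j ` ?A"
  proof (intro set_eqI iffI)
    fix I assume "I \<in> {I. card I = Suc m \<and> j \<in> I}"
    then have "I = insert j (I - {j})" "I - {j} \<in> ?A" by auto
    then show "I \<in> insert j ` ?A" by blast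
  qed (auto simp: card_insert_if)
  have inj: "inj_on (insert j) ?A"
    by (rule inj_on_inverseI[where g = "\<lambda>I. I - {j}"]) auto
  have "partial_deriv j (elem_sym (Suc m) :: ('k, 'n) hpoly)
      = (\<Sum>I | card I = Suc m \<and> j \<in> I. \<Prod>i\<in>I - {j}. hvar i)"
    unfolding elem_sym_def partial_deriv_sum
    by (simp add: partial_deriv_prod_hvar sum.If_cases Int_def)
  also have "\<dots> = esym hvar (UNIV - {j}) m"
    unfolding eq sum.reindex[OF inj] o_def esym_def
    by (intro sum.cong prod.cong) auto
  finally show ?thesis .
qed

section \<open>Fractions\<close>

lemma ubar_cases:
  fixes a :: "('k::comm_ring_1, 'n) ubar"
  obtains p s where "s \<in> denoms" "a = loc_frac p s"
proof -
  have "\<exists>p s. s \<in> denoms \<and> a = loc_frac p s"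
    by transfer (clarsimp, blast)
  then show ?thesis using that by blast
qed

lemma of_hpoly_add: "of_hpoly (p + q) = of_hpoly p + of_hpoly q"
  and of_hpoly_mult: "of_hpoly (p * q) = of_hpoly p * of_hpoly q"
  by (simp_all add: of_hpoly_def loc_frac_add loc_frac_mult denoms.one)

lemma of_hpoly_0: "of_hpoly 0 = 0" and of_hpoly_1: "of_hpoly 1 = 1"
  unfolding of_hpoly_def by (transfer, simp add: denoms.one)+

lemma of_hpoly_diff: "of_hpoly (p - q) = of_hpoly p - of_hpoly q"
  using of_hpoly_add[of "p - q" q] by simp

lemma of_hpoly_sum: "of_hpoly (\<Sum>i\<in>A. f i) = (\<Sum>i\<in>A. of_hpoly (f i))"
  by (induction A rule: infinite_finite_induct) (simp_all add: of_hpoly_0 of_hpoly_add)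

lemma of_hpoly_prod: "of_hpoly (\<Prod>i\<in>A. f i) = (\<Prod>i\<in>A. of_hpoly (f i))"
  by (induction A rule: infinite_finite_induct) (simp_all add: of_hpoly_1 of_hpoly_mult)

lemma of_hpoly_esym: "of_hpoly (esym f S k) = esym (\<lambda>i. of_hpoly (f i)) S k"
  by (simp add: esym_def of_hpoly_sum of_hpoly_prod)

lemma of_hpoly_of_nat: "of_hpoly (of_nat n) = of_nat n"
  by (induction n) (simp_all add: of_hpoly_0 of_hpoly_1 of_hpoly_add)

lemma of_hpoly_of_int: "of_hpoly (of_int k) = of_int k"
  by (cases k rule: int_diff_cases) (simp add: of_hpoly_diff of_hpoly_of_nat)

lemma of_hpoly_numeral: "of_hpoly (numeral n) = numeral n"
  using of_hpoly_of_int[of "numeral n"] by simp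

lemmas of_hpoly_simps = of_hpoly_0 of_hpoly_1 of_hpoly_numeral of_hpoly_of_int
  of_hpoly_add of_hpoly_diff of_hpoly_mult

lemma loc_frac_times_denom: "s \<in> denoms \<Longrightarrow> loc_frac p s * of_hpoly s = of_hpoly p"
  by (simp add: of_hpoly_def loc_frac_mult loc_frac_eq_iff denoms.one denoms_mult)

lemma loc_frac_inverse: "s \<in> denoms \<Longrightarrow> loc_frac 1 s * of_hpoly s = 1"
  by (simp add: loc_frac_times_denom of_hpoly_1)

text \<open>Reduces the evaluation of a fraction to an identity without denominators.\<close>

lemma loc_frac_eqI:
  assumes "s \<in> denoms" "a * of_hpoly s = of_hpoly p"
  shows "loc_frac p s = a"
proof -
  have inv: "of_hpoly s * loc_frac 1 s = 1"
    using loc_frac_inverse[OF assms(1)] by (simp add: mult.commute)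
  have "loc_frac p s * of_hpoly s * loc_frac 1 s = a * of_hpoly s * loc_frac 1 s"
    using assms by (simp add: loc_frac_times_denom)
  then show ?thesis by (simp add: mult.assoc inv)
qed

lemma loc_frac_eq_mult_inverse: "s \<in> denoms \<Longrightarrow> loc_frac p s = of_hpoly p * loc_frac 1 s"
  by (rule loc_frac_eqI) (simp_all add: loc_frac_inverse mult.assoc)

abbreviation H :: "'n \<Rightarrow> ('k::comm_ring_1, 'n) ubar" where
  "H i \<equiv> of_hpoly (hvar i)"

lemma H_update_same: "H(i := H i) = H"
  by (rule fun_upd_triv)

lemma of_hpoly_hdiff: "of_hpoly (hdiff i j) = H i - H j"
  by (simp add: hdiff_def of_hpoly_diff)

lemma hdiff_inverse:
  assumes "i \<noteq> j"
  obtains w where "w * (H i - H j + of_int k) = 1"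
  using that loc_frac_times_denom[OF hdiff_add_of_int_in_denoms[OF assms], of 1 k]
  by (simp add: of_hpoly_simps of_hpoly_hdiff)

section \<open>Moving coefficients past operators\<close>

lemma coef_0: "coef 0 = 0"
  using coef_hom(1)[of 0 0] by simp

lemma coef_diff: "coef (a - b) = coef a - coef b"
  using coef_hom(1)[of "a - b" b] by simp

lemma coef_uminus: "coef (- a) = - coef a"
  using coef_diff[of 0 a] by (simp add: coef_0)

lemma coef_commute: "coef a * coef b = coef b * coef a"
  by (simp add: mult.commute flip: coef_hom)

text \<open>Passing \<open>x_j\<close> or \<open>D_j\<close> transforms coefficients by a shift automorphism of the localization.
  A relation between the coefficients on the two sides serves in its place: it is closed
  under the ring operations and under inverses, so the defining relations for the \<open>h_i\<close> extend to
  fractions, while a substitution in fractions would first have to be shown well defined.\<close>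

definition intertwines ::
    "('k::comm_ring_1, 'n::{finite, linorder}) Diff \<Rightarrow> ('k, 'n) ubar \<Rightarrow> ('k, 'n) ubar \<Rightarrow> bool" where
  "intertwines z a b \<longleftrightarrow> z * coef a = coef b * z"

lemma intertwines_0: "intertwines z 0 0" and intertwines_1: "intertwines z 1 1"
  by (simp_all add: intertwines_def coef_0 coef_hom)

lemma intertwines_add: "intertwines z a b \<Longrightarrow> intertwines z a' b' \<Longrightarrow> intertwines z (a + a') (b + b')"
  by (simp add: intertwines_def coef_hom distrib_left distrib_right)

lemma intertwines_diff: "intertwines z a b \<Longrightarrow> intertwines z a' b' \<Longrightarrow> intertwines z (a - a') (b - b')"
  by (simp add: intertwines_def coef_diff left_diff_distrib right_diff_distrib)

lemma intertwines_mult: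
  assumes "intertwines z a b" "intertwines z a' b'"
  shows "intertwines z (a * a') (b * b')"
  using assms unfolding intertwines_def coef_hom by (metis mult.assoc)

lemma intertwines_numeral: "intertwines z (numeral n) (numeral n)"
  by (induction n) (simp_all only: numeral.simps intertwines_1 intertwines_add)

lemma intertwines_sum:
  "(\<And>x. x \<in> A \<Longrightarrow> intertwines z (f x) (g x)) \<Longrightarrow> intertwines z (\<Sum>x\<in>A. f x) (\<Sum>x\<in>A. g x)"
  by (induction A rule: infinite_finite_induct) (auto intro: intertwines_0 intertwines_add)

lemma intertwines_prod:
  "(\<And>x. x \<in> A \<Longrightarrow> intertwines z (f x) (g x)) \<Longrightarrow> intertwines z (\<Prod>x\<in>A. f x) (\<Prod>x\<in>A. g x)"
  by (induction A rule: infinite_finite_induct) (auto intro: intertwines_1 intertwines_mult)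

lemma intertwines_esym:
  "(\<And>i. i \<in> S \<Longrightarrow> intertwines z (f i) (g i)) \<Longrightarrow> intertwines z (esym f S k) (esym g S k)"
  unfolding esym_def by (intro intertwines_sum intertwines_prod) auto

lemma intertwines_compose: "intertwines y b c \<Longrightarrow> intertwines z a b \<Longrightarrow> intertwines (y * z) a c"
  unfolding intertwines_def by (metis mult.assoc)

text \<open>Multiply \<open>z * coef s = coef s' * z\<close> by the inverse of \<open>s'\<close> on the left and by that of \<open>s\<close>
  on the right.\<close>

lemma intertwines_inverse:
  assumes "intertwines z s s'" "t * s = 1" "t' * s' = 1"
  shows "intertwines z t t'"
proof -
  have "z * coef t = coef (t' * s') * z * coef t"
    by (simp add: assms(3) coef_hom)
  also have "\<dots> = coef t' * (z * coef s) * coef t"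
    using assms(1) by (simp add: intertwines_def coef_hom mult.assoc)
  also have "\<dots> = coef t' * z * coef (t * s)"
    by (simp add: coef_hom mult.assoc coef_commute[of t s])
  finally show ?thesis by (simp add: assms(2) coef_hom intertwines_def)
qed

lemma intertwines_loc_frac:
  assumes st: "s \<in> denoms" "intertwines z (of_hpoly p) p'" "intertwines z (of_hpoly s) s'" "t' * s' = 1"
  shows "intertwines z (loc_frac p s) (p' * t')"
proof -
  have "intertwines z (of_hpoly p * loc_frac 1 s) (p' * t')"
    by (rule intertwines_mult[OF st(2) intertwines_inverse[OF st(3) loc_frac_inverse[OF st(1)] st(4)]])
  then show ?thesis
    by (simp only: loc_frac_eq_mult_inverse[OF st(1), of p, symmetric])
qed

lemma coef_hconst: "coef (of_hpoly (hconst c)) = abs_Diff (scalar c)"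
  using Diff_eq_of_defrel[OF defrel.coef_scalar, of c] by (simp add: coef.abs_eq)

lemma coef_hconst_central:
  fixes z :: "('k::comm_ring_1, 'n::{finite, linorder}) Diff"
  shows "z * coef (of_hpoly (hconst c)) = coef (of_hpoly (hconst c)) * z"
proof -
  have "y * scalar c = scalar c * y" for y :: "('k, 'n) free_alg"
    by (induction y rule: poly_mapping_single_induct)
       (simp_all add: scalar_def mult_single mult.commute distrib_left distrib_right)
  moreover obtain y where "z = abs_Diff y"
    by (metis Diff.abs_eq_iff Quotient3_Diff Quotient3_def)
  ultimately show ?thesis by (simp add: coef_hconst times_Diff.abs_eq)
qed

lemma intertwines_xgen: "intertwines (xgen j) (H i) ((H(j := H j - 1)) i)"
proof -
  have "intertwines (xgen j) (H i + (if i = j then 1 else 0)) (H i)"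
    using Diff_relations(1)[of i j, symmetric] by (simp add: intertwines_def of_hpoly_simps split: if_splits)
  then show ?thesis
    using intertwines_diff[OF _ intertwines_1, of "xgen j" "H i + 1" "H i"] by (cases "i = j") auto
qed

lemma intertwines_dgen: "intertwines (dgen j) (H i) ((H(j := H j + 1)) i)"
proof -
  have "intertwines (dgen j) (H i - (if i = j then 1 else 0)) (H i)"
    using Diff_relations(2)[of i j, symmetric] by (simp add: intertwines_def of_hpoly_simps split: if_splits)
  then show ?thesis
    using intertwines_add[OF _ intertwines_1, of "dgen j" "H i - 1" "H i"] by (cases "i = j") auto
qed

text \<open>The products \<open>N_j\<close>, of weight zero.\<close>

definition dx :: "'n \<Rightarrow> ('k::comm_ring_1, 'n::{finite, linorder}) Diff" where
  "dx j = dgen j * xgen j"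

lemma intertwines_dx_H: "intertwines (dx j) (H i) (H i)"
proof -
  have "intertwines (dgen j) ((H(j := H j - 1)) i) (H i)"
    using intertwines_dgen[of j i] intertwines_diff[OF intertwines_dgen[of j j] intertwines_1]
    by (cases "i = j") auto
  then show ?thesis
    unfolding dx_def using intertwines_compose intertwines_xgen by blast
qed

text \<open>The shifts of \<open>h_j\<close> by \<open>D_j\<close> and \<open>x_j\<close> cancel, and constants are central; these generate
  the polynomials, and inverses follow.\<close>

lemma dx_commutes_coef: "dx j * coef a = coef a * dx j"
proof -
  have poly: "intertwines (dx j) (of_hpoly p) (of_hpoly p)" for p
  proof (induction p rule: hpoly_induct)
    case (const c)
    then show ?case by (simp add: intertwines_def coef_hconst_central)
  qed (simp_all add: of_hpoly_simps intertwines_dx_H intertwines_add intertwines_mult)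
  obtain p s where s: "s \<in> denoms" and a: "a = loc_frac p s"
    by (rule ubar_cases)
  have "intertwines (dx j) (loc_frac p s) (of_hpoly p * loc_frac 1 s)"
    by (rule intertwines_loc_frac[OF s poly poly loc_frac_inverse[OF s]])
  then show ?thesis
    unfolding a intertwines_def by (simp only: loc_frac_eq_mult_inverse[OF s, of p, symmetric])
qed

section \<open>Exchange of the generators with the weight-zero products\<close>

text \<open>The quadratic relations order the indices in one direction only; this turns them around.\<close>

lemma coef_swap:
  assumes "a = coef q * b" "q' * q = 1"
  shows "b = coef q' * a"
  using assms by (metis coef_hom(2,3) mult.assoc mult_1_left)

text \<open>The factor is \<open>h_ij / (h_ij - 1)\<close>, written in terms of \<open>g = h_i - 1\<close> and \<open>w = 1 / (g - h_j)\<close>.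
  For \<open>i < j\<close> it comes from \<open>x_i x_j\<close> alone, as \<open>(h_ij + 1) / h_ij\<close> shifted by \<open>D_j\<close>. For \<open>i > j\<close> it is the
  product of the factor \<open>h_ij (h_ij - 2) / (h_ij - 1)\<^sup>2\<close> of \<open>x_i D_j\<close> and of \<open>(h_ij - 1) / (h_ij - 2)\<close>, which is
  the factor \<open>h_ij / (h_ij - 1)\<close> of \<open>x_i x_j\<close> shifted by \<open>D_j\<close>.\<close>

lemma xgen_dx:
  fixes i j :: "'n::{finite, linorder}" and w :: "('k::comm_ring_1, 'n) ubar"
  assumes ij: "i \<noteq> j" and w: "w * (H i - 1 - H j) = 1"
  shows "xgen i * dx j = coef ((H i - 1 - H j + 1) * w) * (dx j * xgen i)"
proof -
  have hd: "hdiff i j \<in> denoms" "hdiff i j - 1 \<in> denoms"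
    using ij by (rule hdiff_in_denoms hdiff_minus_one_in_denoms)+
  have Hi: "intertwines (dgen j) (H i :: ('k, 'n) ubar) (H i)"
    using intertwines_dgen[of j i] ij by simp
  have Hj: "intertwines (dgen j) (H j :: ('k, 'n) ubar) (H j + 1)"
    using intertwines_dgen[of j j] by simp
  have "intertwines (dgen j) (H i - H j :: ('k, 'n) ubar) (H i - (H j + 1))"
    using Hi Hj by (rule intertwines_diff)
  then have Hij: "intertwines (dgen j) (of_hpoly (hdiff i j) :: ('k, 'n) ubar) (H i - 1 - H j)"
    by (simp add: of_hpoly_hdiff diff_diff_eq add.commute)
  note d_rules = Hij intertwines_1 intertwines_add intertwines_diff
  show ?thesis
  proof (cases "i < j")
    case True
    let ?q = "loc_frac (hdiff i j + 1) (hdiff i j) :: ('k, 'n) ubar"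
    have "intertwines (dgen j) ?q ((H i - 1 - H j + 1) * w)"
      using hd(1) _ Hij w
      by (rule intertwines_loc_frac) (unfold of_hpoly_simps, intro d_rules)
    then have q: "dgen j * coef ?q = coef ((H i - 1 - H j + 1) * w) * dgen j"
      by (simp only: intertwines_def)
    have "xgen i * dx j = (dgen j * (xgen i * xgen j) :: ('k, 'n) Diff)"
      unfolding dx_def using Diff_relations(5)[OF True] by (metis mult.assoc)
    also have "\<dots> = (dgen j * coef ?q) * (xgen j * xgen i)"
      using Diff_relations(3)[OF True] by (metis mult.assoc)
    finally show ?thesis unfolding q dx_def by (simp add: mult.assoc)
  next
    case False
    with ij have ji: "j < i" by simp
    let ?h = "H i - H j :: ('k, 'n) ubar"
    let ?r = "loc_frac (hdiff i j * (hdiff i j - 2)) ((hdiff i j - 1)\<^sup>2) :: ('k, 'n) ubar"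
    let ?q = "loc_frac (hdiff i j) (hdiff i j - 1) :: ('k, 'n) ubar"
    \<comment> \<open>The shift by \<open>D_j\<close> moves the denominator \<open>h_ij - 1\<close> to \<open>h_ij - 2\<close>.\<close>
    obtain v :: "('k, 'n) ubar" where "v * (?h + of_int (- 2)) = 1"
      using hdiff_inverse[OF ij] .
    then have v: "v * (?h - 2) = 1"
      by simp
    have w': "w * (?h - 1) = 1"
      using w by (simp add: algebra_simps)
    have r: "?r = ?h * (?h - 2) * w * w"
    proof (rule loc_frac_eqI)
      show "(hdiff i j - 1 :: ('k, 'n) hpoly)\<^sup>2 \<in> denoms"
        using ij by (rule hdiff_minus_one_square_in_denoms)
      have "?h * (?h - 2) * w * w * ((?h - 1) * (?h - 1)) = ?h * (?h - 2) * (w * (?h - 1)) * (w * (?h - 1))"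
        by (simp only: mult_ac)
      then show "?h * (?h - 2) * w * w * of_hpoly ((hdiff i j - 1)\<^sup>2) = of_hpoly (hdiff i j * (hdiff i j - 2))"
        unfolding w' by (simp add: of_hpoly_simps of_hpoly_hdiff power2_eq_square)
    qed
    have "xgen j * xgen i = coef (loc_frac (hdiff j i + 1) (hdiff j i) :: ('k, 'n) ubar) * (xgen i * xgen j)"
      using Diff_relations(3)[OF ji] by (simp add: mult.assoc)
    moreover have "?q * loc_frac (hdiff j i + 1) (hdiff j i) = 1"
    proof -
      have "?q * loc_frac (hdiff j i + 1) (hdiff j i)
          = loc_frac (hdiff i j * (hdiff j i + 1)) ((hdiff i j - 1) * hdiff j i)"
        using hd(2) ij by (intro loc_frac_mult hdiff_in_denoms) auto
      also have "\<dots> = 1"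
        using hd(2) ij by (intro loc_frac_eqI denoms_mult hdiff_in_denoms)
          (auto simp: hdiff_def algebra_simps)
      finally show ?thesis .
    qed
    ultimately have swap: "xgen i * xgen j = coef ?q * (xgen j * xgen i)"
      by (rule coef_swap)
    have "intertwines (dgen j) ?q ((H i - 1 - H j) * v)"
    proof (rule intertwines_loc_frac[OF hd(2) Hij])
      show "intertwines (dgen j) (of_hpoly (hdiff i j - 1) :: ('k, 'n) ubar) (H i - 1 - H j - 1)"
        unfolding of_hpoly_simps by (intro d_rules)
      show "v * (H i - 1 - H j - 1) = 1"
        using v by (simp add: algebra_simps)
    qed
    then have q: "dgen j * coef ?q = coef ((?h - 1) * v) * dgen j"
      by (simp add: intertwines_def diff_diff_eq add.commute)
    have "xgen i * dx j = (xgen i * dgen j) * xgen j"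
      by (simp add: dx_def mult.assoc)
    also have "\<dots> = coef ?r * dgen j * (xgen i * xgen j)"
      unfolding Diff_relations(6)[OF ji] by (simp add: mult.assoc)
    also have "\<dots> = coef ?r * (dgen j * coef ?q) * (xgen j * xgen i)"
      unfolding swap by (simp add: mult.assoc)
    also have "\<dots> = coef (?r * ((?h - 1) * v)) * (dx j * xgen i)"
      unfolding q dx_def by (simp add: mult.assoc coef_hom)
    also have "?r * ((?h - 1) * v) = (v * (?h - 2)) * (w * (?h - 1)) * (?h * w)"
      unfolding r by (simp only: mult_ac)
    also have "\<dots> = (H i - 1 - H j + 1) * w"
      unfolding v w' by simp
    finally show ?thesis .
  qed
qed

text \<open>The summand \<open>j = i\<close> has denominator one, so that the sum contains \<open>N_i\<close> itself.\<close>

lemma xgen_dgen_same: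
  "(xgen i * dgen i :: ('k::comm_ring_1, 'n::{finite, linorder}) Diff)
    = dx i + (\<Sum>j\<in>UNIV - {i}. coef (loc_frac 1 (1 - hdiff i j)) * dx j) - 1"
proof -
  have "loc_frac 1 (1 - hdiff i i) = (1 :: ('k, 'n) ubar)"
    using one_minus_hdiff_in_denoms by (rule loc_frac_eqI) (simp add: hdiff_def)
  then show ?thesis
    unfolding Diff_relations(7) by (simp add: dx_def sum.remove[where A = UNIV and x = i] coef_hom mult.assoc)
qed

lemma xgen_dx_same:
  fixes i :: "'n::{finite, linorder}" and w :: "'n \<Rightarrow> ('k::comm_ring_1, 'n) ubar"
  assumes w: "\<And>j. j \<noteq> i \<Longrightarrow> w j * (H i - 1 - H j) = 1"
  shows "xgen i * dx i = dx i * xgen i - (\<Sum>j\<in>UNIV - {i}. coef (w j) * (dx j * xgen i)) - xgen i"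
proof -
  have frac: "loc_frac 1 (1 - hdiff i j) = - w j" if "j \<noteq> i" for j
    using one_minus_hdiff_in_denoms
    by (rule loc_frac_eqI) (use w[OF that] in \<open>simp add: of_hpoly_simps of_hpoly_hdiff algebra_simps\<close>)
  have "xgen i * dx i = xgen i * dgen i * xgen i"
    by (simp add: dx_def mult.assoc)
  also have "\<dots> = dx i * xgen i - (\<Sum>j\<in>UNIV - {i}. coef (w j) * (dx j * xgen i)) - xgen i"
    by (simp add: xgen_dgen_same frac coef_uminus sum_negf left_diff_distrib distrib_right
        sum_distrib_right mult.assoc)
  finally show ?thesis .
qed

text \<open>The counterpart of \<open>xgen_dx\<close> with \<open>g = h_i\<close>; the factor is \<open>(h_ij + 1) / h_ij\<close>. For \<open>j < i\<close> it comes
  from \<open>D_j D_i\<close> alone. For \<open>i < j\<close> the factor of \<open>x_j D_i\<close>, shifted by \<open>D_j\<close>, is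
  \<open>(h_ij - 1) (h_ij + 1) / h_ij\<^sup>2\<close>, and that of \<open>D_j D_i\<close> is \<open>h_ij / (h_ij - 1)\<close>.\<close>

lemma dx_dgen:
  fixes i j :: "'n::{finite, linorder}" and w :: "('k::comm_ring_1, 'n) ubar"
  assumes ij: "i \<noteq> j" and w: "w * (H i - H j) = 1"
  shows "dx j * dgen i = coef ((H i - H j + 1) * w) * (dgen i * dx j)"
proof (cases "j < i")
  case True
  have "loc_frac (hdiff j i - 1) (hdiff j i) = (H i - H j + 1) * w"
  proof (rule loc_frac_eqI)
    have "(H i - H j + 1) * w * (H j - H i) = - (H i - H j + 1) * (w * (H i - H j))"
      by (simp add: algebra_simps)
    then show "(H i - H j + 1) * w * of_hpoly (hdiff j i) = of_hpoly (hdiff j i - 1)"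
      by (simp add: w of_hpoly_simps of_hpoly_hdiff)
  qed (use ij in \<open>auto intro: hdiff_in_denoms\<close>)
  moreover have "dx j * dgen i = (dgen j * dgen i * xgen j :: ('k, 'n) Diff)"
    unfolding dx_def using Diff_relations(5)[OF True] by (metis mult.assoc)
  ultimately show ?thesis
    unfolding Diff_relations(4)[OF True] by (simp add: dx_def mult.assoc)
next
  case False
  with ij have i_less: "i < j" by simp
  let ?h = "H i - H j :: ('k, 'n) ubar"
  let ?r = "loc_frac (hdiff j i * (hdiff j i - 2)) ((hdiff j i - 1)\<^sup>2) :: ('k, 'n) ubar"
  let ?q = "loc_frac (hdiff i j) (hdiff i j - 1) :: ('k, 'n) ubar"
  have hd: "hdiff i j \<in> denoms" "hdiff i j - 1 \<in> denoms"
    using ij by (rule hdiff_in_denoms hdiff_minus_one_in_denoms)+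
  have "intertwines (dgen j) (H j - H i :: ('k, 'n) ubar) (H j + 1 - H i)"
    using intertwines_diff[OF intertwines_dgen[of j j] intertwines_dgen[of j i]] ij by simp
  then have Hji: "intertwines (dgen j) (of_hpoly (hdiff j i) :: ('k, 'n) ubar) (1 - ?h)"
    by (simp add: of_hpoly_hdiff algebra_simps)
  note d_rules = Hji intertwines_1 intertwines_mult intertwines_add intertwines_diff
  have "intertwines (dgen j) ?r ((1 - ?h) * (1 - ?h - 2) * (w * w))"
  proof (rule intertwines_loc_frac)
    show "(hdiff j i - 1 :: ('k, 'n) hpoly)\<^sup>2 \<in> denoms"
      using ij by (intro hdiff_minus_one_square_in_denoms) auto
    show "intertwines (dgen j) (of_hpoly (hdiff j i * (hdiff j i - 2)) :: ('k, 'n) ubar)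
        ((1 - ?h) * (1 - ?h - 2))"
      unfolding of_hpoly_simps by (intro d_rules intertwines_numeral)
    show "intertwines (dgen j) (of_hpoly ((hdiff j i - 1)\<^sup>2) :: ('k, 'n) ubar) ((1 - ?h - 1) * (1 - ?h - 1))"
      unfolding of_hpoly_simps power2_eq_square by (intro d_rules)
    have "w * w * ((1 - ?h - 1) * (1 - ?h - 1)) = (w * ?h) * (w * ?h)"
      by (simp add: algebra_simps)
    then show "w * w * ((1 - ?h - 1) * (1 - ?h - 1)) = 1"
      by (simp add: w)
  qed
  then have r: "dgen j * coef ?r = coef ((1 - ?h) * (1 - ?h - 2) * (w * w)) * dgen j"
    by (simp only: intertwines_def)
  have "dgen i * dgen j = coef (loc_frac (hdiff i j - 1) (hdiff i j) :: ('k, 'n) ubar) * (dgen j * dgen i)"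
    using Diff_relations(4)[OF i_less] by (simp add: mult.assoc)
  moreover have "?q * loc_frac (hdiff i j - 1) (hdiff i j) = 1"
    unfolding loc_frac_mult[OF hd(2,1)]
    by (rule loc_frac_eqI[OF denoms_mult[OF hd(2,1)]]) (simp add: mult.commute)
  ultimately have swap: "dgen j * dgen i = coef ?q * (dgen i * dgen j)"
    by (rule coef_swap)
  have q: "?q * (?h - 1) = ?h"
    using loc_frac_times_denom[OF hd(2), of "hdiff i j"] by (simp add: of_hpoly_simps of_hpoly_hdiff)
  have "dx j * dgen i = dgen j * (xgen j * dgen i)"
    by (simp add: dx_def mult.assoc)
  also have "\<dots> = (dgen j * coef ?r) * (dgen i * xgen j)"
    unfolding Diff_relations(6)[OF i_less] by (simp add: mult.assoc)
  also have "\<dots> = coef ((1 - ?h) * (1 - ?h - 2) * (w * w)) * (dgen j * dgen i) * xgen j"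
    unfolding r by (simp add: mult.assoc)
  also have "\<dots> = coef ((1 - ?h) * (1 - ?h - 2) * (w * w) * ?q) * (dgen i * dx j)"
    unfolding swap dx_def by (simp add: mult.assoc coef_hom)
  also have "(1 - ?h) * (1 - ?h - 2) * (w * w) * ?q = (?q * (?h - 1)) * (?h + 1) * w * w"
    by (simp add: algebra_simps)
  also have "\<dots> = (w * ?h) * ((?h + 1) * w)"
    unfolding q by (simp only: mult_ac)
  finally show ?thesis by (simp add: w)
qed

lemma dx_dgen_same:
  fixes i :: "'n::{finite, linorder}" and w :: "'n \<Rightarrow> ('k::comm_ring_1, 'n) ubar"
  assumes w: "\<And>j. j \<noteq> i \<Longrightarrow> w j * (H i - H j) = 1"
  shows "dx i * dgen i = dgen i * dx i - (\<Sum>j\<in>UNIV - {i}. coef (w j) * (dgen i * dx j)) - dgen i"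
proof -
  have frac: "dgen i * coef (loc_frac 1 (1 - hdiff i j)) = - coef (w j) * dgen i" if "j \<noteq> i" for j
  proof -
    have "intertwines (dgen i) (H i - H j :: ('k, 'n) ubar) (H i + 1 - H j)"
      using intertwines_diff[OF intertwines_dgen[of i i] intertwines_dgen[of i j]] that by simp
    then have "intertwines (dgen i) (of_hpoly (1 - hdiff i j) :: ('k, 'n) ubar) (1 - (H i + 1 - H j))"
      unfolding of_hpoly_simps of_hpoly_hdiff by (rule intertwines_diff[OF intertwines_1])
    moreover have "- w j * (1 - (H i + 1 - H j)) = 1"
      using w[OF that] by (simp add: algebra_simps)
    moreover have "intertwines (dgen i) (of_hpoly 1 :: ('k, 'n) ubar) 1"
      by (simp add: of_hpoly_1 intertwines_1)
    ultimately have "intertwines (dgen i) (loc_frac 1 (1 - hdiff i j)) (1 * - w j)"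
      using one_minus_hdiff_in_denoms by (intro intertwines_loc_frac)
    then show ?thesis by (simp add: intertwines_def coef_uminus)
  qed
  have "dx i * dgen i = dgen i * (xgen i * dgen i)"
    by (simp add: dx_def mult.assoc)
  also have "\<dots> = dgen i * dx i
      + (\<Sum>j\<in>UNIV - {i}. dgen i * coef (loc_frac 1 (1 - hdiff i j) :: ('k, 'n) ubar) * dx j) - dgen i"
    by (simp add: xgen_dgen_same right_diff_distrib distrib_left sum_distrib_left mult.assoc)
  also have "\<dots> = dgen i * dx i - (\<Sum>j\<in>UNIV - {i}. coef (w j) * (dgen i * dx j)) - dgen i"
    by (simp add: frac sum_negf mult.assoc)
  finally show ?thesis .
qed

section \<open>Centrality\<close>

text \<open>The common form of the commutation with \<open>x_i\<close> and \<open>D_i\<close>: \<open>L\<close> and \<open>M\<close> are the products of a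
  generator \<open>z\<close> with the \<open>N_j\<close> in the two orders. The expansion of \<open>L i\<close> contributes to the
  coefficient of every \<open>M j\<close>, where \<open>esym_exchange\<close> absorbs it, and to that of \<open>z\<close>, where it is
  the increment in \<open>esym_shift\<close>.\<close>

lemma esym_combination_exchange:
  fixes f w :: "'n \<Rightarrow> ('k::comm_ring_1, 'n::{finite, linorder}) ubar"
    and L M :: "'n \<Rightarrow> ('k, 'n) Diff"
  assumes w: "\<And>j. j \<noteq> i \<Longrightarrow> w j * (g - f j) = 1"
    and other: "\<And>j. j \<noteq> i \<Longrightarrow> L j = coef ((g - f j + 1) * w j) * M j"
    and same: "L i = M i - (\<Sum>j\<in>UNIV - {i}. coef (w j) * M j) - z"
  shows "(\<Sum>j\<in>UNIV. coef (esym (f(i := g)) (UNIV - {j}) m) * L j)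
      - coef (esym (f(i := g)) UNIV (Suc m)) * z
    = (\<Sum>j\<in>UNIV. coef (esym (f(i := g + 1)) (UNIV - {j}) m) * M j)
      - coef (esym (f(i := g + 1)) UNIV (Suc m)) * z"
proof -
  let ?e = "\<lambda>j. esym (f(i := g)) (UNIV - {j}) m" and ?e' = "\<lambda>j. esym (f(i := g + 1)) (UNIV - {j}) m"
  have "coef (?e j) * L j - coef (?e i) * (coef (w j) * M j) = coef (?e' j) * M j" if "j \<noteq> i" for j
  proof -
    have "coef (?e j) * L j - coef (?e i) * (coef (w j) * M j)
        = coef (?e j * ((g - f j + 1) * w j) - ?e i * w j) * M j"
      by (simp add: other[OF that] coef_hom coef_diff left_diff_distrib mult.assoc)
    also have "?e j * ((g - f j + 1) * w j) - ?e i * w j = ?e' j"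
      using that by (intro esym_exchange w) auto
    finally show ?thesis .
  qed
  then have "(\<Sum>j\<in>UNIV - {i}. coef (?e j) * L j) - coef (?e i) * (\<Sum>j\<in>UNIV - {i}. coef (w j) * M j)
      = (\<Sum>j\<in>UNIV - {i}. coef (?e' j) * M j)"
    by (simp add: sum_distrib_left flip: sum_subtractf)
  moreover have "?e' i = ?e i"
    by (simp add: esym_update_other)
  moreover have "coef (esym (f(i := g + 1)) UNIV (Suc m)) = coef (esym (f(i := g)) UNIV (Suc m)) + coef (?e i)"
    by (simp only: esym_shift coef_hom)
  ultimately show ?thesis
    by (simp add: sum.remove[where A = UNIV and x = i] same distrib_left distrib_right
        left_diff_distrib right_diff_distrib)
qed

lemma c_elem_eq:
  "c_elem (Suc m) = (\<Sum>j\<in>UNIV. coef (esym H (UNIV - {j}) m) * dx j) - coef (esym H UNIV (Suc m))"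
  unfolding c_elem_def partial_deriv_elem_sym
  by (simp add: elem_sym_eq_esym of_hpoly_esym dx_def mult.assoc)

lemma c_elem_commutes_coef: "c_elem (Suc m) * coef a = coef a * c_elem (Suc m)"
proof -
  have "coef b * dx j * coef a = coef a * (coef b * dx j)" for b j
    by (metis dx_commutes_coef coef_commute mult.assoc)
  then show ?thesis
    by (simp add: c_elem_eq left_diff_distrib right_diff_distrib sum_distrib_left sum_distrib_right
        coef_commute)
qed

text \<open>Here the coefficients evaluated at \<open>g = h_i - 1\<close> are those of \<open>x_i c_k\<close> after \<open>x_i\<close> has passed them,
  and those evaluated at \<open>g + 1 = h_i\<close> are the original ones of \<open>c_k x_i\<close>.\<close>

lemma c_elem_commutes_xgen:
  fixes i :: "'n::{finite, linorder}"
  shows "c_elem (Suc m) * xgen i = xgen i * (c_elem (Suc m) :: ('k::comm_ring_1, 'n) Diff)"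
proof -
  have "\<exists>w :: ('k, 'n) ubar. w * (H i - 1 - H j) = 1" if ji: "j \<noteq> i" for j
  proof -
    obtain v :: "('k, 'n) ubar" where "v * (H i - H j + of_int (- 1)) = 1"
      using hdiff_inverse[OF ji[symmetric]] .
    then show ?thesis by (intro exI[of _ v]) (simp add: diff_diff_eq add.commute)
  qed
  then obtain w :: "'n \<Rightarrow> ('k, 'n) ubar" where w: "\<And>j. j \<noteq> i \<Longrightarrow> w j * (H i - 1 - H j) = 1"
    by metis
  let ?f = "H(i := H i - 1) :: 'n \<Rightarrow> ('k, 'n) ubar"
  have e: "xgen i * coef (esym H S k) = coef (esym ?f S k) * xgen i" for S k
    using intertwines_esym[OF intertwines_xgen] by (simp only: intertwines_def)
  have "xgen i * c_elem (Suc m) = (\<Sum>j\<in>UNIV. coef (esym ?f (UNIV - {j}) m) * (xgen i * dx j))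
      - coef (esym ?f UNIV (Suc m)) * xgen i"
    unfolding c_elem_eq right_diff_distrib sum_distrib_left e
    by (simp add: e flip: mult.assoc)
  also have "\<dots> = (\<Sum>j\<in>UNIV. coef (esym (H(i := H i - 1 + 1)) (UNIV - {j}) m) * (dx j * xgen i))
      - coef (esym (H(i := H i - 1 + 1)) UNIV (Suc m)) * xgen i"
    using w by (intro esym_combination_exchange[where w = w] xgen_dx xgen_dx_same) auto
  also have "\<dots> = c_elem (Suc m) * xgen i"
    unfolding diff_add_cancel H_update_same
    by (simp add: c_elem_eq left_diff_distrib sum_distrib_right mult.assoc)
  finally show ?thesis ..
qed

text \<open>The roles are reversed: \<open>g = h_i\<close> gives the original coefficients of \<open>c_k D_i\<close>, and \<open>g + 1\<close> those
  of \<open>D_i c_k\<close> after \<open>D_i\<close> has passed them.\<close>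

lemma c_elem_commutes_dgen:
  fixes i :: "'n::{finite, linorder}"
  shows "c_elem (Suc m) * dgen i = dgen i * (c_elem (Suc m) :: ('k::comm_ring_1, 'n) Diff)"
proof -
  have "\<exists>w :: ('k, 'n) ubar. w * (H i - H j) = 1" if "j \<noteq> i" for j
    using hdiff_inverse[where i = i and j = j and k = 0] that by (metis add_0_right of_int_0)
  then obtain w :: "'n \<Rightarrow> ('k, 'n) ubar" where w: "\<And>j. j \<noteq> i \<Longrightarrow> w j * (H i - H j) = 1"
    by metis
  let ?f = "H(i := H i + 1) :: 'n \<Rightarrow> ('k, 'n) ubar"
  have e: "dgen i * coef (esym H S k) = coef (esym ?f S k) * dgen i" for S k
    using intertwines_esym[OF intertwines_dgen] by (simp only: intertwines_def)
  have "c_elem (Suc m) * dgen i = (\<Sum>j\<in>UNIV. coef (esym (H(i := H i)) (UNIV - {j}) m) * (dx j * dgen i))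
      - coef (esym (H(i := H i)) UNIV (Suc m)) * dgen i"
    unfolding H_update_same by (simp add: c_elem_eq left_diff_distrib sum_distrib_right mult.assoc)
  also have "\<dots> = (\<Sum>j\<in>UNIV. coef (esym ?f (UNIV - {j}) m) * (dgen i * dx j))
      - coef (esym ?f UNIV (Suc m)) * dgen i"
    using w by (intro esym_combination_exchange[where w = w] dx_dgen dx_dgen_same) auto
  also have "\<dots> = dgen i * c_elem (Suc m)"
    unfolding c_elem_eq right_diff_distrib sum_distrib_left e
    by (simp add: e flip: mult.assoc)
  finally show ?thesis .
qed

text \<open>Scalars are among the coefficients, so the three kinds of generators suffice; in particular
  an element is central once it commutes with them.\<close>

lemma Diff_induct [case_names coef xgen dgen add mult]:
  fixes z :: "('k::comm_ring_1, 'n::{finite, linorder}) Diff"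
  assumes coef: "\<And>a. P (coef a)" and x: "\<And>i. P (xgen i)" and d: "\<And>i. P (dgen i)"
    and add: "\<And>y z. P y \<Longrightarrow> P z \<Longrightarrow> P (y + z)" and mult: "\<And>y z. P y \<Longrightarrow> P z \<Longrightarrow> P (y * z)"
  shows "P z"
proof -
  have gen: "P (abs_Diff (gen g))" for g
    using coef x d by (cases g) (simp_all add: coef.abs_eq xgen.abs_eq dgen.abs_eq)
  have scalar: "P (abs_Diff (scalar c))" for c
    using coef[of "of_hpoly (hconst c)"] by (simp add: coef_hconst)
  have word: "P (abs_Diff (Poly_Mapping.single (Word gs) 1))" for gs
  proof (induction gs)
    case Nil
    then show ?case using scalar[of 1] by (simp add: scalar_def zero_free_monoid_def)
  next
    case (Cons g gs)
    have "Poly_Mapping.single (Word (g # gs)) 1 = gen g * Poly_Mapping.single (Word gs) (1 :: 'k)"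
      by (simp add: gen_def mult_single plus_free_monoid_def)
    then show ?case using mult[OF gen Cons] by (simp add: times_Diff.abs_eq)
  qed
  have "P (abs_Diff y)" for y :: "('k, 'n) free_alg"
  proof (induction y rule: poly_mapping_single_induct)
    case zero
    then show ?case using scalar[of 0] by (simp add: scalar_def)
  next
    case (single v c)
    obtain gs where "v = Word gs" by (cases v)
    then have "Poly_Mapping.single v c = scalar c * Poly_Mapping.single (Word gs) 1"
      by (simp add: scalar_def mult_single)
    then show ?case using mult[OF scalar word] by (simp add: times_Diff.abs_eq)
  next
    case (add y y')
    then show ?case using assms(4) by (simp flip: plus_Diff.abs_eq)
  qed
  then show ?thesis by (metis Diff.abs_eq_iff Quotient3_Diff Quotient3_def)
qed

theorem proposition3:
  fixes k :: nat
  assumes "1 \<le> k" and "k \<le> CARD('n)"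
  shows "(c_elem k :: ('k::{comm_ring_1, ring_char_0}, 'n::{finite, linorder}) Diff) \<in> ring_center"
proof -
  obtain m where k: "k = Suc m" using assms(1) by (cases k) auto
  have "c_elem k * z = z * c_elem k" for z :: "('k, 'n) Diff"
    unfolding k
  proof (induction z rule: Diff_induct)
    case (mult y z)
    then show ?case by (metis mult.assoc)
  qed (simp_all add: c_elem_commutes_coef c_elem_commutes_xgen c_elem_commutes_dgen
      distrib_left distrib_right)
  then show ?thesis by (simp add: ring_center_def)
qed

end
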